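(* Let $n\ge 2$ and $a\in\mathrm{Part}(n)$. If $a$ is not the maximum element of $\mathrm{Part}(n)$, then $\mathit{NextPartition}(a)$ returns the partition immediately next to $a$ in $\mathrm{Part}(n)$. If $\mathit{NextPartition}(a)$ returns null, then $a$ is the maximum element of $\mathrm{Part}(n)$.
   Context: For an integer $n\ge 2$, $\mathrm{Part}(n)$ is the set of non-decreasing sequences $(a_1,\dots,a_k)$ of positive integers with $k\ge 2$ and $\sum_{i=1}^k a_i=n$. It is totally ordered lexicographically: for distinct $a=(a_i)_k$, $b=(b_i)_m$, let $j$ be the least index $\le\min\{k,m\}$ with $a_j\ne b_j$; then $a<b$ iff $a_j<b_j$. An element $b$ is immediately next to $a$ if $b>a$ and every $c\in\mathrm{Part}(n)$ with $c>a$ satisfies $c\ge b$. Procedure $\mathit{NextPartition}$, on input $a=(a_1,\dots,a_k)\in\mathrm{Part}(n)$ with $n=\sum_i a_i$: - If $a_1\ne\lfloor n/2\rfloor$: - if $a_k-a_{k-1}\le 1$, return $(a_1,\dots,a_{k-2},a_{k-1}+a_k)$; - otherwise, let $c=a_{k-1}+1$, $d=a_k-1$, $q=\lfloor d/c\rfloor$, $r=d-qc$; if $q>1$ return $(a_1,\dots,a_{k-2},\underbrace{c,\dots,c}_{q\text{ times}},c+r)$, and if $q\le 1$ return $(a_1,\dots,a_{k-2},c,d)$. - If $a_1=\lfloor n/2\rfloor$: if $n\ne 3$ return null; if $n=3$, return null if $a_2=\lceil n/2\rceil$, and return $(1,2)$ otherwise. *)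

theory Defs
  imports Main
begin

definition Part :: "nat \<Rightarrow> nat list set" where
  "Part n = {a. sorted a \<and> (\<forall>x \<in> set a. 0 < x) \<and> 2 \<le> length a \<and> sum_list a = n}"

text \<open>
  No clause for proper prefixes is needed: two distinct positive sequences with the same sum
  always differ at some index below both lengths.
\<close>

definition part_less :: "nat list \<Rightarrow> nat list \<Rightarrow> bool" where
  "part_less a b \<longleftrightarrow>
     (\<exists>j < min (length a) (length b). (\<forall>i < j. a ! i = b ! i) \<and> a ! j < b ! j)"

definition part_le :: "nat list \<Rightarrow> nat list \<Rightarrow> bool" where
  "part_le a b \<longleftrightarrow> a = b \<or> part_less a b"

definition immediately_next :: "nat \<Rightarrow> nat list \<Rightarrow> nat list \<Rightarrow> bool" where
  "immediately_next n a b \<longleftrightarrow>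
     b \<in> Part n \<and> part_less a b \<and> (\<forall>c \<in> Part n. part_less a c \<longrightarrow> part_le b c)"

definition is_maximum :: "nat \<Rightarrow> nat list \<Rightarrow> bool" where
  "is_maximum n a \<longleftrightarrow> a \<in> Part n \<and> (\<forall>c \<in> Part n. part_le c a)"

text \<open>
  Lists are indexed from 0, so the entries $a_1$, $a_2$, $a_{k-1}$, $a_k$ of the sequence are
  \<open>a ! 0\<close>, \<open>a ! 1\<close>, \<open>a ! (k - 2)\<close>, \<open>a ! (k - 1)\<close>. Floor and ceiling of $n/2$ are
  \<open>n div 2\<close> and \<open>(n + 1) div 2\<close>; null is \<open>None\<close>. On elements of \<open>Part n\<close> no subtraction
  below is truncated.
\<close>

definition NextPartition :: "nat list \<Rightarrow> nat list option" where
  "NextPartition a =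
     (let n = sum_list a; k = length a in
      if a ! 0 \<noteq> n div 2 then
        (if a ! (k - 1) - a ! (k - 2) \<le> 1
         then Some (take (k - 2) a @ [a ! (k - 2) + a ! (k - 1)])
         else
           (let c = a ! (k - 2) + 1; d = a ! (k - 1) - 1; q = d div c; r = d - q * c in
            if q > 1 then Some (take (k - 2) a @ replicate q c @ [c + r])
            else Some (take (k - 2) a @ [c, d])))
      else if n \<noteq> 3 then None
      else if a ! 1 = (n + 1) div 2 then None
      else Some [1, 2])"

end

theory Submission
  imports Defs
begin

text \<open>
  Write a partition as \<open>p @ [x, y]\<close> and put \<open>c = x + 1\<close>. Except at the maximum
  \<open>[\<lfloor>n/2\<rfloor>, \<lceil>n/2\<rceil>]\<close>, all branches of the procedure return the same
  thing: \<open>p\<close> followed by the partition of \<open>x + y\<close> into copies of \<open>c\<close> and one last part in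
  \<open>[c, 2c)\<close>. That tail is the least sequence with entries at least \<open>c\<close> and sum \<open>x + y\<close>.
  A larger partition which agrees with \<open>p @ [x, y]\<close> on \<open>p\<close> must exceed \<open>x\<close> at the next entry,
  as the sum leaves no room for a first difference at \<open>y\<close>; all its later entries
  are then at least \<open>c\<close>.
\<close>

lemma not_part_less_Nil [simp]: "\<not> part_less [] b" "\<not> part_less a []"
  by (auto simp: part_less_def)

text \<open>Turns the order by index of first difference into a recursion on lists, so that later
  comparisons go by structural induction.\<close>

lemma part_less_Cons [simp]:
  "part_less (x # xs) (y # ys) \<longleftrightarrow> x < y \<or> x = y \<and> part_less xs ys"
proof
  assume "part_less (x # xs) (y # ys)"
  then obtain j where j: "j < min (length (x # xs)) (length (y # ys))"
    "\<forall>i<j. (x # xs) ! i = (y # ys) ! i" "(x # xs) ! j < (y # ys) ! j"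
    unfolding part_less_def by blast
  show "x < y \<or> x = y \<and> part_less xs ys"
  proof (cases j)
    case (Suc m)
    have "\<forall>i<m. xs ! i = ys ! i"
      using j(2) Suc by force
    then show ?thesis
      using j Suc unfolding part_less_def by fastforce
  qed (use j in auto)
next
  assume "x < y \<or> x = y \<and> part_less xs ys"
  then show "part_less (x # xs) (y # ys)"
  proof
    assume "x < y"
    then show ?thesis
      unfolding part_less_def by (intro exI[of _ 0]) auto
  next
    assume "x = y \<and> part_less xs ys"
    then obtain j where "x = y" "j < min (length xs) (length ys)"
      "\<forall>i<j. xs ! i = ys ! i" "xs ! j < ys ! j"
      unfolding part_less_def by blast
    then show ?thesis
      unfolding part_less_def by (intro exI[of _ "Suc j"]) (auto simp: nth_Cons split: nat.split)
  qed
qed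

lemma part_le_Cons [simp]:
  "part_le (x # xs) (y # ys) \<longleftrightarrow> x < y \<or> x = y \<and> part_le xs ys"
  by (auto simp: part_le_def)

lemma part_less_append_left [simp]: "part_less (p @ a) (p @ b) \<longleftrightarrow> part_less a b"
  by (induction p) auto

text \<open>If \<open>t\<close> starts above \<open>c\<close>, it is already larger; if it starts
  with \<open>c\<close>, strip that entry and induct on \<open>q\<close>. For \<open>q = 0\<close>
  the sum is below \<open>2 * c\<close>, which leaves room for one entry only.\<close>

lemma part_le_replicate_append:
  assumes "\<forall>z \<in> set t. c \<le> z" "sum_list t = q * c + (c + r)" "r < c"
  shows "part_le (replicate q c @ [c + r]) t"
  using assms
proof (induction q arbitrary: t)
  case 0
  then obtain h u where t: "t = h # u" by (cases t) auto
  have "u = []"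
    using 0 t by (cases u) auto
  then show ?case
    using 0 t by (simp add: part_le_def)
next
  case (Suc q)
  then obtain h u where t: "t = h # u" by (cases t) auto
  show ?case
    using Suc.prems Suc.IH[of u] t by (cases "h = c") auto
qed

text \<open>Since \<open>x + y = (x + 1) + (y - 1)\<close>, one part \<open>x + 1\<close> is set
  aside and \<open>y - 1\<close> is divided by \<open>x + 1\<close>; the remainder is merged into
  the part set aside.\<close>

definition next_tail :: "nat \<Rightarrow> nat \<Rightarrow> nat list" where
  "next_tail x y = replicate ((y - 1) div (x + 1)) (x + 1) @ [x + 1 + (y - 1) mod (x + 1)]"

lemma sum_list_next_tail:
  assumes "0 < y"
  shows "sum_list (next_tail x y) = x + y"
proof -
  have "(y - 1) div (x + 1) * (x + 1) + (y - 1) mod (x + 1) = y - 1"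
    by (rule div_mult_mod_eq)
  then show ?thesis
    using assms by (simp add: next_tail_def sum_list_replicate)
qed

lemma next_tail_ge: "z \<in> set (next_tail x y) \<Longrightarrow> x < z"
  by (auto simp: next_tail_def)

lemma sorted_next_tail: "sorted (next_tail x y)"
  by (auto simp: next_tail_def sorted_append)

lemma next_tail_Cons:
  obtains h u where "next_tail x y = h # u" "x < h"
proof (cases "next_tail x y")
  case Nil
  then show thesis by (simp add: next_tail_def)
next
  case (Cons h u)
  then show thesis using that next_tail_ge[of h x y] by simp
qed

lemma part_le_next_tail:
  assumes "part_less (p @ [x, y]) b" "sum_list b = sum_list (p @ [x, y])" "sorted b" "0 < y"
  shows "part_le (p @ next_tail x y) b"
  using assms
proof (induction p arbitrary: b)
  case Nil
  then obtain h u where b: "b = h # u" by (cases b) auto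
  have "\<not> part_less [y] u"
    if "x = h" using Nil b that by (cases u) auto
  then have "x < h" using Nil b by auto
  then have ge: "\<forall>z \<in> set b. x + 1 \<le> z"
    using Nil b by auto
  have "(y - 1) div (x + 1) * (x + 1) + (y - 1) mod (x + 1) = y - 1"
    by (rule div_mult_mod_eq)
  then have "sum_list b = (y - 1) div (x + 1) * (x + 1) + (x + 1 + (y - 1) mod (x + 1))"
    using Nil by simp
  from part_le_replicate_append[OF ge this] show ?case
    by (simp add: next_tail_def)
next
  case (Cons z p)
  then obtain h u where b: "b = h # u" by (cases b) auto
  show ?case
    using Cons.prems Cons.IH[of u] b by auto
qed

lemma Part_cases:
  assumes "a \<in> Part n"
  obtains p x y where "a = p @ [x, y]" "x \<le> y" "sum_list p + x + y = n"
proof -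
  have a: "sorted a" "2 \<le> length a" "sum_list a = n"
    using assms by (auto simp: Part_def)
  obtain w y where w: "a = w @ [y]"
    using a(2) by (cases a rule: rev_cases) auto
  obtain p x where "w = p @ [x]"
    using a(2) w by (cases w rule: rev_cases) auto
  with w that[of p x y] a show thesis
    by (auto simp: sorted_append)
qed

text \<open>The side condition ensures two entries: for \<open>p = []\<close> and
  \<open>y \<le> x + 1\<close> the tail would be the single entry \<open>x + y\<close>.\<close>

lemma immediately_next_next_tail:
  assumes "p @ [x, y] \<in> Part n" "p \<noteq> [] \<or> x + 1 < y"
  shows "immediately_next n (p @ [x, y]) (p @ next_tail x y)"
proof -
  have a: "0 < x" "x \<le> y" "\<forall>z \<in> set p. 0 < z \<and> z \<le> x" "sorted p" "sum_list p + x + y = n"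
    using assms(1) by (auto simp: Part_def sorted_append)
  have "2 \<le> length (p @ next_tail x y)"
  proof (cases "p = []")
    case True
    then have "0 < (y - 1) div (x + 1)"
      using assms(2) by (simp add: div_greater_zero_iff)
    then show ?thesis by (simp add: next_tail_def)
  next
    case False
    then have "1 \<le> length p" by (simp add: Suc_le_eq)
    then show ?thesis by (simp add: next_tail_def)
  qed
  moreover have "sorted (p @ next_tail x y)"
    using a next_tail_ge sorted_next_tail by (force simp: sorted_append)
  moreover have "\<forall>z \<in> set (p @ next_tail x y). 0 < z"
    using a next_tail_ge by fastforce
  ultimately have "p @ next_tail x y \<in> Part n"
    using a sum_list_next_tail[of y x] by (simp add: Part_def)
  moreover have "part_less (p @ [x, y]) (p @ next_tail x y)"
    by (rule next_tail_Cons[of x y]) simp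
  ultimately show ?thesis
    using a part_le_next_tail[of p x y] by (auto simp: immediately_next_def Part_def)
qed

lemma is_maximum_halves:
  assumes "[n div 2, y] \<in> Part n"
  shows "is_maximum n [n div 2, y]"
  unfolding is_maximum_def
proof (intro conjI ballI)
  fix b
  assume "b \<in> Part n"
  then have b: "sorted b" "\<forall>z \<in> set b. 0 < z" "2 \<le> length b" "sum_list b = n"
    by (auto simp: Part_def)
  then obtain h m u where bu: "b = h # m # u"
    by (cases b rule: remdups_adj.cases) auto
  have n: "n div 2 + y = n"
    using assms by (simp add: Part_def)
  have hm: "h \<le> m" "h + m + sum_list u = n"
    using b bu by auto
  show "part_le b [n div 2, y]"
  proof (cases "h = n div 2")
    case True
    \<comment> \<open>If \<open>u\<close> is empty, then \<open>m = y\<close>; otherwise its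
      positive entries force \<open>m < y\<close>.\<close>
    then show ?thesis
      using hm n bu b by (cases u) (auto simp: part_le_def)
  next
    case False
    then show ?thesis
      using hm bu by auto
  qed
qed (fact assms)

lemma NextPartition_eq_next_tail:
  assumes "p @ [x, y] \<in> Part n" "p \<noteq> [] \<or> x + 1 < y"
  shows "NextPartition (p @ [x, y]) = Some (p @ next_tail x y)"
proof -
  let ?a = "p @ [x, y]"
  have a: "0 < x" "x \<le> y" "\<forall>z \<in> set p. 0 < z \<and> z \<le> x" "sorted p" "sum_list p + x + y = n"
    using assms(1) by (auto simp: Part_def sorted_append)
  have nth: "?a ! (length ?a - 1) = y" "?a ! (length ?a - 2) = x" "take (length ?a - 2) ?a = p"
    by (simp_all add: nth_append)
  have merge: "next_tail x y = [x + y]" if "y - x \<le> 1"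
    using that a by (simp add: next_tail_def)
  show ?thesis
  proof (cases "?a ! 0 = n div 2")
    case False
    \<comment> \<open>Here \<open>y \<ge> x + 2\<close> makes the quotient exactly 1, so
      \<open>c + r = d\<close> and the pair \<open>c\<close>, \<open>d\<close> is the tail.\<close>
    have split: "next_tail x y = replicate 1 (x + 1) @ [y - 1]"
      if "\<not> y - x \<le> 1" "\<not> (y - 1) div (x + 1) > 1"
    proof -
      have "(y - 1) div (x + 1) > 0"
        using that a by (simp add: div_greater_zero_iff)
      then have q: "(y - 1) div (x + 1) = 1"
        using that by linarith
      have "(y - 1) div (x + 1) * (x + 1) + (y - 1) mod (x + 1) = y - 1"
        by (rule div_mult_mod_eq)
      then show ?thesis
        using q by (simp add: next_tail_def)
    qed
    have r: "(y - 1) - (y - 1) div (x + 1) * (x + 1) = (y - 1) mod (x + 1)"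
      by (rule minus_div_mult_eq_mod)
    have "sum_list ?a = n" using a by simp
    then show ?thesis
      using False merge split
      unfolding NextPartition_def Let_def nth r
      by (simp add: next_tail_def)
  next
    case True
    have "p \<noteq> []"
      using True a assms(2) by auto
    then obtain z u where p: "p = z # u" by (cases p) auto
    then have "z = n div 2" "0 < z" "z \<le> x" "z + sum_list u + x + y = n"
      using True a by auto
    \<comment> \<open>At least three entries, none below \<open>n div 2\<close>, give
      \<open>3 * (n div 2) \<le> n\<close>. As \<open>n div 2\<close> is positive, only
      \<open>[1, 1, 1]\<close> remains, the exceptional case of the procedure.\<close>
    then have n: "n = 3" "z = 1" "x = 1" "y = 1" "sum_list u = 0"
      using a(2) by linarith+
    have "u = []"
      using n a(3) p by (cases u) auto
    then show ?thesis
      using n p by (simp add: NextPartition_def next_tail_def)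
  qed
qed

theorem theorem1:
  fixes n :: nat and a :: "nat list"
  assumes "2 \<le> n" and "a \<in> Part n"
  shows "(\<not> is_maximum n a \<longrightarrow> (\<exists>b. NextPartition a = Some b \<and> immediately_next n a b))
    \<and> (NextPartition a = None \<longrightarrow> is_maximum n a)"
proof -
  obtain p x y where a: "a = p @ [x, y]" "x \<le> y" "sum_list p + x + y = n"
    using assms(2) by (rule Part_cases)
  show ?thesis
  \<comment> \<open>The condition fails only for two entries differing by at most 1, which are the
    two halves of \<open>n\<close>.\<close>
  proof (cases "p \<noteq> [] \<or> x + 1 < y")
    case True
    then show ?thesis
      using assms(2) a NextPartition_eq_next_tail immediately_next_next_tail by auto
  next
    case False
    then have "p = []" "x = n div 2"
      using a by auto
    then show ?thesis
      using is_maximum_halves[of n y] assms(2) a by auto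
  qed
qed

end
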